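(* Let $P\subset\mathbb{R}^N$ be a polytope with vertex set $\{v_1,\dots,v_M\}$, let $v(x)$ denote a vertex of $P$ closest to $x$ in Euclidean norm (with some fixed tie-breaking rule), and for $\gamma\in P$ let $\phi_\gamma(x)=x+(\gamma-v(x))$. Then for every compact $K\subset\mathbb{R}^N$ there exists a bounded convex set $Q\supset K$ with $\phi_\gamma(Q)\subset Q$ for all $\gamma\in P$, which moreover is globally absorbing in the following sense: for every compact subset $P_0$ of the interior of $P$ and every compact $X\subset\mathbb{R}^N$ there exists $n_0$ (depending on $P_0$ and $X$) such that for all $n>n_0$ and all $\gamma_1,\dots,\gamma_n\in P_0$, $$\phi_{\gamma_1}\circ\cdots\circ\phi_{\gamma_n}(X)\subset Q.$$ *)

theory Defs
  imports "HOL-Analysis.Analysis"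
begin

text \<open>The map phi_gamma(x) = x + (gamma - v(x)), where v is a (fixed) nearest-vertex selection.\<close>
definition phi_map :: "('a::euclidean_space \<Rightarrow> 'a) \<Rightarrow> 'a \<Rightarrow> 'a \<Rightarrow> 'a" where
  "phi_map v \<gamma> x = x + (\<gamma> - v x)"

definition phi_comp :: "('a::euclidean_space \<Rightarrow> 'a) \<Rightarrow> 'a list \<Rightarrow> 'a \<Rightarrow> 'a" where
  "phi_comp v gs = foldr (\<lambda>g h. phi_map v g \<circ> h) gs id"

end

theory Submission
  imports Defs
begin

text \<open>
  A unit normal \<open>n\<close> of a convex set causes no trouble at \<open>x\<close> if \<open>v x\<close> maximises \<open>n \<bullet> _\<close>
  over \<open>P\<close>, since then \<open>(\<gamma> - v x) \<bullet> n \<le> 0\<close>. Far from the origin \<open>v x\<close> nearly maximises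
  \<open>x \<bullet> _\<close>, so a large ball fails only at points whose normal \<open>n\<close> is close to a direction \<open>n'\<close>
  exposing a larger face of \<open>P\<close>. The remedy is to shave the ball slightly, by the half-spaces
  \<open>x \<bullet> n \<le> R (1 - \<epsilon>\<^sub>k)\<close>, where \<open>k\<close> is the number of vertices on the face exposed by \<open>n\<close>.
  If \<open>\<epsilon>\<^sub>k\<close> is much smaller than \<open>\<epsilon>\<^sub>k\<^sub>+\<^sub>1\<close>, then the deeper cut orthogonal to \<open>n'\<close> removes all the
  points at which the cut orthogonal to \<open>n\<close> would fail. The shaved body is invariant for every
  large \<open>R\<close>, and inputs at distance \<open>s\<close> from the boundary of \<open>P\<close> decrease \<open>R\<close> by \<open>s\<close>
  in each step, which gives the absorption.
\<close>

text \<open>For the vertex set \<open>V\<close> of a polytope, \<open>t = 0\<close> gives the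
  vertices of the face exposed by \<open>n\<close>; positive \<open>t\<close> also admits
  near-ties.\<close>

definition near_maximizers :: "'a::euclidean_space set \<Rightarrow> real \<Rightarrow> 'a \<Rightarrow> 'a set" where
  "near_maximizers V t n = {w \<in> V. \<forall>u\<in>V. n \<bullet> u \<le> n \<bullet> w + t}"

definition shaved_ball :: "'a::euclidean_space set \<Rightarrow> (nat \<Rightarrow> real) \<Rightarrow> real \<Rightarrow> 'a set" where
  "shaved_ball V \<epsilon> R =
     {x. \<forall>n. norm n = 1 \<longrightarrow> x \<bullet> n \<le> R * (1 - \<epsilon> (card (near_maximizers V 0 n)))}"

section \<open>Exposed faces of nearby directions, and the cut depths\<close>

lemma near_maximizers_mono: "s \<le> t \<Longrightarrow> near_maximizers V s n \<subseteq> near_maximizers V t n"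
  by (force simp: near_maximizers_def)

text \<open>A vertex off the face exposed by \<open>m\<close> loses to some vertex by a positive
  gap. There are finitely many such gaps, so one \<open>r\<close> serves both as radius around
  \<open>m\<close> and as slack.\<close>

lemma near_maximizers_locally_exposed:
  fixes V :: "'a::euclidean_space set"
  assumes "finite V"
  shows "\<exists>r>0. \<forall>n. dist m n < r \<longrightarrow> near_maximizers V r n \<subseteq> near_maximizers V 0 m"
proof -
  have "\<exists>r>0. \<forall>n. dist m n < r \<longrightarrow> n \<bullet> u > n \<bullet> w + r"
    if "u \<in> V" "w \<in> V" "m \<bullet> u > m \<bullet> w" for u w
  proof -
    define g where "g = m \<bullet> (u - w)"
    have g: "g > 0" using that by (simp add: g_def inner_diff_right)
    \<comment> \<open>The gap \<open>g\<close> splits into \<open>r * norm (u - w)\<close>, the most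
      that moving from \<open>m\<close> to \<open>n\<close> can cost, and \<open>2 * r\<close>,
      which exceeds the required \<open>r\<close>.\<close>
    define r where "r = g / (2 + norm (u - w))"
    have r: "r > 0" "r * (2 + norm (u - w)) = g"
      using g by (auto simp: r_def add_pos_nonneg) (smt (verit) norm_ge_zero)
    have "n \<bullet> u > n \<bullet> w + r" if "dist m n < r" for n
    proof -
      have "(m - n) \<bullet> (u - w) \<le> norm (m - n) * norm (u - w)" by (rule norm_cauchy_schwarz)
      also have "\<dots> \<le> r * norm (u - w)"
        using that by (intro mult_right_mono) (auto simp: dist_norm)
      finally show ?thesis
        using r by (simp add: g_def algebra_simps)
    qed
    with r show ?thesis by blast
  qed
  then obtain \<rho> where \<rho>: "\<And>u w. u \<in> V \<Longrightarrow> w \<in> V \<Longrightarrow> m \<bullet> u > m \<bullet> w \<Longrightarrow>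
      \<rho> u w > 0 \<and> (\<forall>n. dist m n < \<rho> u w \<longrightarrow> n \<bullet> u > n \<bullet> w + \<rho> u w)"
    by metis
  \<comment> \<open>The element 1 keeps \<open>S\<close> nonempty when all of \<open>V\<close> ties
    at \<open>m\<close>.\<close>
  define S where "S = insert 1 ((\<lambda>(u, w). \<rho> u w) ` {(u, w) \<in> V \<times> V. m \<bullet> u > m \<bullet> w})"
  have "finite {(u, w) \<in> V \<times> V. m \<bullet> u > m \<bullet> w}"
    by (rule finite_subset[of _ "V \<times> V"]) (use assms in auto)
  then have S: "finite S" "S \<noteq> {}" by (auto simp: S_def)
  have "Min S > 0" using S \<rho> by (auto simp: S_def)
  moreover have "near_maximizers V (Min S) n \<subseteq> near_maximizers V 0 m" if "dist m n < Min S" for n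
  proof
    fix w assume w: "w \<in> near_maximizers V (Min S) n"
    show "w \<in> near_maximizers V 0 m"
    proof (rule ccontr)
      assume "w \<notin> near_maximizers V 0 m"
      then obtain u where u: "u \<in> V" "w \<in> V" "m \<bullet> u > m \<bullet> w"
        using w by (auto simp: near_maximizers_def not_le)
      then have "\<rho> u w \<in> S" by (auto simp: S_def)
      then have "Min S \<le> \<rho> u w" using S by simp
      moreover from this have "n \<bullet> u > n \<bullet> w + \<rho> u w" using \<rho>[OF u] that by simp
      ultimately have "n \<bullet> u > n \<bullet> w + Min S" by linarith
      with w u show False by (force simp: near_maximizers_def)
    qed
  qed
  ultimately show ?thesis by blast
qed

text \<open>Compactness of the sphere makes the slack uniform. The price is a nearby
  \<open>m\<close> in place of \<open>n\<close>, which may itself lie arbitrarily close to a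
  direction exposing a larger face.\<close>

lemma near_maximizers_uniformly_exposed:
  fixes V :: "'a::euclidean_space set"
  assumes "finite V" "\<eta> > 0"
  shows "\<exists>t>0. \<forall>n. norm n = 1 \<longrightarrow>
    (\<exists>m. norm m = 1 \<and> dist m n < \<eta> \<and> near_maximizers V t n \<subseteq> near_maximizers V 0 m)"
proof -
  obtain r where r: "\<And>m. r m > 0"
    "\<And>m n. dist m n < r m \<Longrightarrow> near_maximizers V (r m) n \<subseteq> near_maximizers V 0 m"
    using near_maximizers_locally_exposed[OF assms(1)] by metis
  have "sphere 0 1 \<subseteq> (\<Union>m\<in>sphere (0::'a) 1. ball m (min \<eta> (r m)))"
    using r(1) assms by force
  then obtain T where T: "T \<subseteq> sphere 0 1" "finite T" "sphere 0 1 \<subseteq> (\<Union>m\<in>T. ball m (min \<eta> (r m)))"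
    using compactE_image[OF compact_sphere[of "0::'a" 1], of "sphere 0 1" "\<lambda>m. ball m (min \<eta> (r m))"]
    by (metis open_ball)
  define t where "t = Min (insert 1 (r ` T))"
  have "t > 0" using T r(1) by (auto simp: t_def)
  moreover have "\<exists>m. norm m = 1 \<and> dist m n < \<eta> \<and> near_maximizers V t n \<subseteq> near_maximizers V 0 m"
    if "norm n = 1" for n
  proof -
    from that T(3) obtain m where m: "m \<in> T" "dist m n < \<eta>" "dist m n < r m" by force
    have "t \<le> r m" using T m by (auto simp: t_def)
    then have "near_maximizers V t n \<subseteq> near_maximizers V 0 m"
      using near_maximizers_mono r(2)[OF m(3)] by blast
    moreover have "norm m = 1" using m(1) T(1) by auto
    ultimately show ?thesis using m(2) by blast
  qed
  ultimately show ?thesis by blast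
qed

text \<open>Here \<open>a\<close> and \<open>e\<close> are consecutive depths, \<open>a\<close> for
  the larger faces. The slack is \<open>2 * sqrt e\<close> (distance from \<open>n\<close> to a bad
  point of the rescaled body) times the diameter bound \<open>2 * B\<close>, plus an error
  \<open>e\<close>. The deeper cut removes that point because
  \<open>2 * e + a / 2 < a\<close>.\<close>

definition depth_gap :: "'a::euclidean_space set \<Rightarrow> real \<Rightarrow> real \<Rightarrow> real \<Rightarrow> bool" where
  "depth_gap V B a e \<longleftrightarrow> 0 < e \<and> 5 * e \<le> a \<and> (\<forall>n. norm n = 1 \<longrightarrow>
     (\<exists>m. norm m = 1 \<and> dist m n < a / 2 \<and>
          near_maximizers V (4 * B * sqrt e + e) n \<subseteq> near_maximizers V 0 m))"

lemma depth_gap_exists: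
  fixes V :: "'a::euclidean_space set"
  assumes "finite V" "B \<ge> 0" "a > 0"
  shows "\<exists>e. depth_gap V B a e"
proof -
  obtain t where t: "t > 0" "\<And>n. norm n = 1 \<Longrightarrow>
      \<exists>m. norm m = 1 \<and> dist m n < a / 2 \<and> near_maximizers V t n \<subseteq> near_maximizers V 0 m"
    using near_maximizers_uniformly_exposed[OF assms(1), of "a/2"] assms(3) by auto
  \<comment> \<open>The witness is \<open>d\<^sup>2\<close>, whose root is \<open>d\<close>; as
    \<open>d \<le> 1\<close>, the slack is then at most \<open>d * (4 * B + 1)\<close>.\<close>
  define d where "d = Min {1, a / 5, t / (4 * B + 1)}"
  have d: "d \<le> 1" "d \<le> a / 5" "d \<le> t / (4 * B + 1)"
    unfolding d_def by (rule Min_le; simp)+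
  have d0: "0 < d" using assms t(1) by (auto simp: d_def)
  have dd: "d\<^sup>2 \<le> d" using d d0 by (simp add: power2_eq_square mult_left_le)
  have "4 * B * d + d\<^sup>2 \<le> d * (4 * B + 1)" using dd by (simp add: algebra_simps)
  also have "\<dots> \<le> t" using d(3) assms(2) by (simp add: pos_le_divide_eq)
  finally have le: "near_maximizers V (4 * B * sqrt (d\<^sup>2) + d\<^sup>2) n \<subseteq> near_maximizers V t n" for n
    using d0 by (intro near_maximizers_mono) simp
  have "depth_gap V B a (d\<^sup>2)"
    unfolding depth_gap_def
  proof (intro conjI allI impI)
    show "0 < d\<^sup>2" using d0 by simp
    show "5 * d\<^sup>2 \<le> a" using d(2) dd by linarith
    show "\<exists>m. norm m = 1 \<and> dist m n < a / 2 \<and>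
        near_maximizers V (4 * B * sqrt (d\<^sup>2) + d\<^sup>2) n \<subseteq> near_maximizers V 0 m"
      if "norm n = 1" for n
      using t(2)[OF that] le subset_trans by meson
  qed
  then show ?thesis ..
qed

text \<open>Each gap determines the smaller depth from the larger, so the depths are built downwards
  from 1/2, starting at the largest face.\<close>

lemma depths_exist:
  fixes V :: "'a::euclidean_space set"
  assumes "finite V" "B \<ge> 0"
  shows "\<exists>\<epsilon>. mono \<epsilon> \<and> (\<forall>k. 0 < \<epsilon> k \<and> \<epsilon> k \<le> 1 / 2) \<and> (\<forall>k<card V. depth_gap V B (\<epsilon> (Suc k)) (\<epsilon> k))"
proof -
  obtain G where G: "\<And>a. a > 0 \<Longrightarrow> depth_gap V B a (G a)"
    using depth_gap_exists[OF assms] by metis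
  define e where "e = rec_nat (1 / 2) (\<lambda>_. G)"
  have e0: "e 0 = 1 / 2" and eS: "\<And>i. e (Suc i) = G (e i)" by (simp_all add: e_def)
  have pos: "e i > 0" for i
    by (induction i) (use e0 eS G in \<open>auto simp: depth_gap_def\<close>)
  have gap: "depth_gap V B (e i) (e (Suc i))" for i using G pos eS by simp
  have "e (Suc i) \<le> e i" for i
    using gap[of i] pos[of "Suc i"] by (auto simp: depth_gap_def)
  then have anti: "antimono e" by (simp add: antimono_iff_le_Suc)
  \<comment> \<open>Truncated subtraction makes \<epsilon> constantly 1/2 from \<open>card V\<close>
    on, so monotonicity and the bounds hold for all \<open>k\<close>.\<close>
  define \<epsilon> where "\<epsilon> k = e (card V - k)" for k
  have "mono \<epsilon>" unfolding \<epsilon>_def by (intro monoI antimonoD[OF anti]) simp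
  moreover have "0 < \<epsilon> k \<and> \<epsilon> k \<le> 1 / 2" for k
    using pos antimonoD[OF anti, of 0] e0 by (simp add: \<epsilon>_def)
  moreover have "depth_gap V B (\<epsilon> (Suc k)) (\<epsilon> k)" if "k < card V" for k
    using gap[of "card V - Suc k"] that by (simp add: \<epsilon>_def Suc_diff_Suc)
  ultimately show ?thesis by blast
qed

section \<open>Shape of the shaved ball\<close>

lemma convex_shaved_ball: "convex (shaved_ball V \<epsilon> R)"
proof -
  have "shaved_ball V \<epsilon> R =
      (\<Inter>n\<in>sphere 0 1. {x. n \<bullet> x \<le> R * (1 - \<epsilon> (card (near_maximizers V 0 n)))})"
    by (auto simp: shaved_ball_def inner_commute)
  then show ?thesis by (simp add: convex_INT convex_halfspace_le)
qed

lemma shaved_ball_subset_cball: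
  assumes "R \<ge> 0" "\<And>k. 0 \<le> \<epsilon> k"
  shows "shaved_ball V \<epsilon> R \<subseteq> cball 0 R"
proof
  fix x assume x: "x \<in> shaved_ball V \<epsilon> R"
  show "x \<in> cball 0 R"
  proof (cases "x = 0")
    case False
    define n where "n = x /\<^sub>R norm x"
    have "norm n = 1" using False by (simp add: n_def)
    with x have "x \<bullet> n \<le> R * (1 - \<epsilon> (card (near_maximizers V 0 n)))"
      by (auto simp: shaved_ball_def)
    also have "\<dots> \<le> R" using assms by (simp add: mult_left_le)
    also have "x \<bullet> n = norm x"
      using False by (simp add: n_def dot_square_norm power2_eq_square)
    finally show ?thesis by simp
  qed (use assms in auto)
qed

lemma cball_subset_shaved_ball:
  assumes "R \<ge> 0" "\<And>k. \<epsilon> k \<le> 1 / 2"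
  shows "cball 0 (R / 2) \<subseteq> shaved_ball V \<epsilon> R"
  unfolding shaved_ball_def
proof (intro subsetI CollectI allI impI)
  fix x n :: 'a assume x: "x \<in> cball 0 (R / 2)" and n: "norm n = 1"
  have "x \<bullet> n \<le> norm x * norm n" by (rule norm_cauchy_schwarz)
  also have "\<dots> \<le> R * (1 / 2)" using x n by simp
  also have "\<dots> \<le> R * (1 - \<epsilon> (card (near_maximizers V 0 n)))"
    using assms(1) assms(2)[of "card (near_maximizers V 0 n)"] by (intro mult_left_mono) auto
  finally show "x \<bullet> n \<le> R * (1 - \<epsilon> (card (near_maximizers V 0 n)))" .
qed

lemma shaved_ball_mono:
  assumes "R \<le> R'" "\<And>k. \<epsilon> k \<le> 1"
  shows "shaved_ball V \<epsilon> R \<subseteq> shaved_ball V \<epsilon> R'"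
proof -
  have "R * (1 - \<epsilon> k) \<le> R' * (1 - \<epsilon> k)" for k
    using assms by (intro mult_right_mono) auto
  then show ?thesis unfolding shaved_ball_def by (blast intro: order_trans)
qed

section \<open>One step of the dynamics\<close>

text \<open>
  If \<open>w\<close> were not on the face exposed by \<open>n\<close>, then the deeper cut of a nearby direction \<open>m\<close>,
  whose face contains \<open>w\<close> as well, would have removed \<open>x\<close>.
\<close>
lemma maximizer_at_active_cut:
  fixes V :: "'a::euclidean_space set"
  assumes V: "finite V" "\<And>u. u \<in> V \<Longrightarrow> norm u \<le> B"
    and \<epsilon>: "mono \<epsilon>" "\<And>k. 0 < \<epsilon> k" "\<And>k. k < card V \<Longrightarrow> depth_gap V B (\<epsilon> (Suc k)) (\<epsilon> k)"
    and R: "R > 0" "C \<le> R * \<epsilon> 0"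
    and x: "x \<in> shaved_ball V \<epsilon> R"
    and w: "w \<in> V" "\<And>u. u \<in> V \<Longrightarrow> x \<bullet> u \<le> x \<bullet> w + C"
    and n: "norm n = 1" "x \<bullet> n \<ge> R * (1 - \<epsilon> (card (near_maximizers V 0 n))) - C"
  shows "w \<in> near_maximizers V 0 n"
proof (rule ccontr)
  assume wn: "w \<notin> near_maximizers V 0 n"
  define k where "k = card (near_maximizers V 0 n)"
  \<comment> \<open>Rescaling removes \<open>R\<close> from the estimates: the additive error
    \<open>C\<close> becomes at most \<open>\<epsilon> k\<close>.\<close>
  define y where "y = x /\<^sub>R R"
  have xy: "x = R *\<^sub>R y" using R by (simp add: y_def)
  have sub: "near_maximizers V 0 n \<subset> V" using wn w by (auto simp: near_maximizers_def)
  then have k: "k < card V" unfolding k_def using V(1) by (rule psubset_card_mono[rotated])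
  have CR: "C \<le> R * \<epsilon> k"
    using R monoD[OF \<epsilon>(1), of 0 k] mult_left_mono[of "\<epsilon> 0" "\<epsilon> k" R] by linarith
  have "R * (y \<bullet> n) \<ge> R * (1 - 2 * \<epsilon> k)"
    using n(2) CR unfolding xy k_def[symmetric] by (simp add: algebra_simps)
  then have yn: "y \<bullet> n \<ge> 1 - 2 * \<epsilon> k" using R by simp
  have "shaved_ball V \<epsilon> R \<subseteq> cball 0 R"
    using R(1) \<epsilon>(2) by (intro shaved_ball_subset_cball) (simp_all add: less_imp_le)
  then have "norm x \<le> R" using x by auto
  then have y1: "norm y \<le> 1" using R by (simp add: y_def divide_simps)
  have "(norm (n - y))\<^sup>2 = 1 + (norm y)\<^sup>2 - 2 * (y \<bullet> n)"
    using n(1) by (simp add: power2_norm_eq_inner inner_diff inner_commute norm_eq_1)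
  also have "\<dots> \<le> 4 * \<epsilon> k" using yn power_le_one[OF norm_ge_zero y1, of 2] by linarith
  also have "\<dots> = (2 * sqrt (\<epsilon> k))\<^sup>2" using \<epsilon>(2)[of k] by (simp add: power_mult_distrib)
  finally have ny: "norm (n - y) \<le> 2 * sqrt (\<epsilon> k)"
    by (rule power2_le_imp_le) (use \<epsilon>(2)[of k] in simp)
  \<comment> \<open>\<open>w\<close> maximises \<open>y \<bullet> _\<close> up to
    \<open>\<epsilon> k\<close>; passing from \<open>y\<close> to \<open>n\<close> adds at most
    \<open>norm (n - y)\<close> times the diameter of \<open>V\<close>.\<close>
  have "n \<bullet> u \<le> n \<bullet> w + (4 * B * sqrt (\<epsilon> k) + \<epsilon> k)" if u: "u \<in> V" for u
  proof -
    have "norm (u - w) \<le> 2 * B" using V(2)[OF u] V(2)[OF w(1)] norm_triangle_ineq4[of u w] by linarith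
    then have "norm (n - y) * norm (u - w) \<le> (2 * sqrt (\<epsilon> k)) * (2 * B)"
      using ny \<epsilon>(2)[of k] by (intro mult_mono) auto
    then have "(n - y) \<bullet> (u - w) \<le> 4 * B * sqrt (\<epsilon> k)"
      using norm_cauchy_schwarz[of "n - y" "u - w"] by (simp add: mult.commute mult.left_commute)
    moreover have "R * (y \<bullet> (u - w)) \<le> R * \<epsilon> k"
      using w(2)[OF u] CR unfolding xy by (simp add: inner_diff_right algebra_simps)
    then have "y \<bullet> (u - w) \<le> \<epsilon> k" using R by simp
    ultimately show ?thesis by (simp add: algebra_simps)
  qed
  then have wmem: "w \<in> near_maximizers V (4 * B * sqrt (\<epsilon> k) + \<epsilon> k) n"
    using w(1) by (simp add: near_maximizers_def)
  from \<epsilon>(3)[OF k] n(1) obtain m where m: "norm m = 1" "dist m n < \<epsilon> (Suc k) / 2"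
      "near_maximizers V (4 * B * sqrt (\<epsilon> k) + \<epsilon> k) n \<subseteq> near_maximizers V 0 m"
      and gap: "5 * \<epsilon> k \<le> \<epsilon> (Suc k)"
    unfolding depth_gap_def by blast
  have "B \<ge> 0" using V(2)[OF w(1)] norm_ge_zero[of w] by linarith
  then have "0 \<le> 4 * B * sqrt (\<epsilon> k) + \<epsilon> k" using \<epsilon>(2)[of k] by simp
  then have "near_maximizers V 0 n \<subset> near_maximizers V 0 m"
    using m(3) wmem wn near_maximizers_mono[of 0] by blast
  moreover have "finite (near_maximizers V 0 m)" using V(1) by (simp add: near_maximizers_def)
  ultimately have "Suc k \<le> card (near_maximizers V 0 m)"
    unfolding k_def by (simp add: Suc_le_eq psubset_card_mono)
  then have "\<epsilon> (Suc k) \<le> \<epsilon> (card (near_maximizers V 0 m))" using \<epsilon>(1) by (simp add: monoD)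
  then have "R * (1 - \<epsilon> (card (near_maximizers V 0 m))) \<le> R * (1 - \<epsilon> (Suc k))"
    using R by (intro mult_left_mono) auto
  moreover have "x \<bullet> m \<le> R * (1 - \<epsilon> (card (near_maximizers V 0 m)))"
    using x m(1) by (auto simp: shaved_ball_def)
  ultimately have "R * (y \<bullet> m) \<le> R * (1 - \<epsilon> (Suc k))" unfolding xy by simp
  then have "y \<bullet> m \<le> 1 - \<epsilon> (Suc k)" using R by simp
  \<comment> \<open>Moving from \<open>n\<close> to \<open>m\<close> costs less than
    \<open>\<epsilon> (Suc k) / 2\<close>, so \<open>y \<bullet> m\<close> would still exceed
    \<open>1 - \<epsilon> (Suc k)\<close>.\<close>
  moreover have "y \<bullet> (n - m) \<le> norm y * norm (n - m)" by (rule norm_cauchy_schwarz)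
  moreover have "norm y * norm (n - m) \<le> dist m n"
    using y1 by (simp add: dist_norm norm_minus_commute mult_left_le_one_le)
  ultimately show False
    using yn m(2) gap \<epsilon>(2)[of k] by (simp add: inner_diff_right)
qed

text \<open>If \<open>v x\<close> maximises \<open>n \<bullet> _\<close>, the step moves inwards by
  at least \<open>s\<close> along \<open>n\<close>. Otherwise \<open>maximizer_at_active_cut\<close>
  leaves room \<open>B\<^sup>2 + 2 * B + 1\<close> below the cut, enough for a step of length
  \<open>2 * B\<close> and a shrinkage of at most 1.\<close>

lemma phi_map_shaved_ball:
  fixes V :: "'a::euclidean_space set"
  assumes V: "finite V" "\<And>u. u \<in> V \<Longrightarrow> norm u \<le> B"
    and \<epsilon>: "mono \<epsilon>" "\<And>k. 0 < \<epsilon> k" "\<And>k. \<epsilon> k \<le> 1"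
      "\<And>k. k < card V \<Longrightarrow> depth_gap V B (\<epsilon> (Suc k)) (\<epsilon> k)"
    and v: "\<And>x. v x \<in> V" "\<And>x w. w \<in> V \<Longrightarrow> norm (x - v x) \<le> norm (x - w)"
    and R: "R > 0" "B\<^sup>2 + 2 * B + 1 \<le> R * \<epsilon> 0"
    and x: "x \<in> shaved_ball V \<epsilon> R"
    and s: "0 \<le> s" "s \<le> 1"
    and \<gamma>: "norm \<gamma> \<le> B"
      "\<And>n w. norm n = 1 \<Longrightarrow> w \<in> near_maximizers V 0 n \<Longrightarrow> \<gamma> \<bullet> n + s \<le> w \<bullet> n"
  shows "phi_map v \<gamma> x \<in> shaved_ball V \<epsilon> (R - s)"
  unfolding shaved_ball_def
proof (intro CollectI allI impI)
  fix n :: 'a assume n: "norm n = 1"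
  define r where "r = 1 - \<epsilon> (card (near_maximizers V 0 n))"
  have r: "0 \<le> r" "r \<le> 1" using \<epsilon>(2,3) less_imp_le by (auto simp: r_def)
  then have sr: "0 \<le> s * r" "s * r \<le> s" "s * r \<le> 1" using s by (auto simp: mult_left_le mult_le_one)
  have xn: "x \<bullet> n \<le> R * r" using x n by (auto simp: shaved_ball_def r_def)
  have B0: "B \<ge> 0" using \<gamma>(1) norm_ge_zero[of \<gamma>] by linarith
  \<comment> \<open>A nearest vertex maximises
    \<open>2 * (x \<bullet> u) - (norm u)\<^sup>2\<close>, hence \<open>x \<bullet> _\<close> up to
    \<open>B\<^sup>2 / 2\<close>.\<close>
  have vmax: "x \<bullet> u \<le> x \<bullet> v x + (B\<^sup>2 + 2 * B + 1)" if "u \<in> V" for u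
  proof -
    have "(norm (x - v x))\<^sup>2 \<le> (norm (x - u))\<^sup>2" using v(2)[OF that] by (intro power_mono) auto
    then have "2 * (x \<bullet> u) + (norm (v x))\<^sup>2 \<le> 2 * (x \<bullet> v x) + (norm u)\<^sup>2"
      by (simp add: power2_norm_eq_inner inner_diff inner_commute)
    moreover have "(norm u)\<^sup>2 \<le> B\<^sup>2" using V(2)[OF that] by (intro power_mono) auto
    ultimately show ?thesis using B0 zero_le_power2[of "norm (v x)"] zero_le_power2[of B] by linarith
  qed
  have "x \<bullet> n + (\<gamma> - v x) \<bullet> n \<le> (R - s) * r"
  proof (cases "v x \<in> near_maximizers V 0 n")
    case True
    then show ?thesis using \<gamma>(2)[OF n True] xn sr by (simp add: algebra_simps)
  next
    case False
    then have "x \<bullet> n < R * r - (B\<^sup>2 + 2 * B + 1)"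
      using maximizer_at_active_cut[OF V \<epsilon>(1,2,4) R x v(1) vmax n] by (force simp: r_def)
    moreover have "(\<gamma> - v x) \<bullet> n \<le> norm (\<gamma> - v x)"
      using norm_cauchy_schwarz[of "\<gamma> - v x" n] n by simp
    moreover have "norm (\<gamma> - v x) \<le> 2 * B"
      using \<gamma>(1) V(2)[OF v(1), of x] norm_triangle_ineq4[of \<gamma> "v x"] by linarith
    ultimately show ?thesis unfolding left_diff_distrib[of R s r] using sr zero_le_power2[of B] by linarith
  qed
  then show "phi_map v \<gamma> x \<bullet> n \<le> (R - s) * (1 - \<epsilon> (card (near_maximizers V 0 n)))"
    by (simp add: phi_map_def inner_add_left r_def)
qed

section \<open>Invariance and absorption\<close>

lemma inner_le_near_maximizer:
  assumes "p \<in> convex hull V" "w \<in> near_maximizers V 0 n"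
  shows "p \<bullet> n \<le> w \<bullet> n"
proof -
  have "V \<subseteq> {z. n \<bullet> z \<le> n \<bullet> w}" using assms(2) by (auto simp: near_maximizers_def)
  then have "convex hull V \<subseteq> {z. n \<bullet> z \<le> n \<bullet> w}" by (rule hull_minimal) (rule convex_halfspace_le)
  with assms(1) show ?thesis by (auto simp: inner_commute)
qed

lemma phi_comp_Nil [simp]: "phi_comp v [] x = x"
  by (simp add: phi_comp_def)

lemma phi_comp_Cons [simp]: "phi_comp v (g # gs) x = phi_map v g (phi_comp v gs x)"
  by (simp add: phi_comp_def)

theorem theorem6p1:
  fixes P :: "'a::euclidean_space set" and v :: "'a \<Rightarrow> 'a"
  assumes "polytope P"
    and "\<And>x. v x extreme_point_of P"
    and "\<And>x w. w extreme_point_of P \<Longrightarrow> norm (x - v x) \<le> norm (x - w)"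
    and "compact K"
  shows "\<exists>Q. bounded Q \<and> convex Q \<and> K \<subseteq> Q \<and>
           (\<forall>\<gamma>\<in>P. phi_map v \<gamma> ` Q \<subseteq> Q) \<and>
           (\<forall>P0 X. compact P0 \<and> P0 \<subseteq> interior P \<and> compact X \<longrightarrow>
              (\<exists>n0::nat. \<forall>gs. length gs > n0 \<and> set gs \<subseteq> P0 \<longrightarrow> phi_comp v gs ` X \<subseteq> Q))"
proof -
  define V where "V = {w. w extreme_point_of P}"
  have fin: "finite V"
    unfolding V_def using assms(1)
    by (intro finite_polyhedron_extreme_points polytope_imp_polyhedron)
  have P_hull: "P = convex hull V"
    unfolding V_def using assms(1)
    by (intro Krein_Milman_Minkowski polytope_imp_compact polytope_imp_convex)
  have v: "\<And>x. v x \<in> V" "\<And>x w. w \<in> V \<Longrightarrow> norm (x - v x) \<le> norm (x - w)"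
    using assms(2,3) by (auto simp: V_def)
  obtain B where B: "B > 0" "\<And>p. p \<in> P \<Longrightarrow> norm p \<le> B"
    using polytope_imp_bounded[OF assms(1)] by (auto simp: bounded_pos)
  have VB: "norm u \<le> B" if "u \<in> V" for u
    using that B by (auto simp: V_def extreme_point_of_def)
  obtain \<epsilon> where \<epsilon>: "mono \<epsilon>" "\<And>k. 0 < \<epsilon> k" "\<And>k. \<epsilon> k \<le> 1 / 2"
    "\<And>k. k < card V \<Longrightarrow> depth_gap V B (\<epsilon> (Suc k)) (\<epsilon> k)"
    using depths_exist[OF fin, of B] B(1) by auto
  have \<epsilon>1: "\<epsilon> k \<le> 1" for k using \<epsilon>(3)[of k] by linarith
  obtain b where b: "b > 0" "K \<subseteq> cball 0 b"
    using bounded_subset_ballD[OF compact_imp_bounded[OF assms(4)], of 0] ball_subset_cball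
      subset_trans by metis
  \<comment> \<open>The first bound puts \<open>K\<close> into the ball of radius
    \<open>R0 / 2\<close>, which survives the shaving; the second is the size condition for one
    step.\<close>
  define R0 where "R0 = max (2 * b) ((B\<^sup>2 + 2 * B + 1) / \<epsilon> 0)"
  have "2 * b \<le> R0" "(B\<^sup>2 + 2 * B + 1) / \<epsilon> 0 \<le> R0" by (simp_all add: R0_def)
  then have R0: "R0 > 0" "2 * b \<le> R0" "B\<^sup>2 + 2 * B + 1 \<le> R0 * \<epsilon> 0"
    using b(1) \<epsilon>(2)[of 0] by (simp_all add: pos_divide_le_eq)
  \<comment> \<open>With \<open>s = 0\<close> the slack condition is just membership in
    \<open>P\<close> and the step gives invariance; \<open>s > 0\<close> gives the strict decrease
    of the radius.\<close>
  have step: "phi_map v \<gamma> x \<in> shaved_ball V \<epsilon> (R - s)"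
    if "R \<ge> R0" "x \<in> shaved_ball V \<epsilon> R" "0 \<le> s" "s \<le> 1" "\<gamma> \<in> P"
      and slack: "\<And>n. norm n = 1 \<Longrightarrow> \<gamma> + s *\<^sub>R n \<in> P" for \<gamma> x R s
  proof (rule phi_map_shaved_ball[OF fin VB \<epsilon>(1,2) \<epsilon>1 \<epsilon>(4) v])
    show "R > 0" using R0 that by simp
    show "B\<^sup>2 + 2 * B + 1 \<le> R * \<epsilon> 0"
      using R0(3) mult_right_mono[OF that(1), of "\<epsilon> 0"] \<epsilon>(2)[of 0] by linarith
    show "\<gamma> \<bullet> n + s \<le> w \<bullet> n" if n: "norm n = 1" "w \<in> near_maximizers V 0 n" for n w
    proof -
      have "(\<gamma> + s *\<^sub>R n) \<bullet> n \<le> w \<bullet> n"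
        using slack[OF n(1)] n(2) unfolding P_hull by (rule inner_le_near_maximizer)
      then show ?thesis using n(1) by (simp add: inner_add_left norm_eq_1)
    qed
  qed (simp_all add: that B)
  define Q where "Q = shaved_ball V \<epsilon> R0"
  have sub: "shaved_ball V \<epsilon> R \<subseteq> shaved_ball V \<epsilon> R'" if "R \<le> R'" for R R'
    by (rule shaved_ball_mono[OF that \<epsilon>1])
  have "bounded Q"
    unfolding Q_def
    by (rule bounded_subset[OF bounded_cball shaved_ball_subset_cball])
      (use R0(1) \<epsilon>(2) in \<open>simp_all add: less_imp_le\<close>)
  moreover have "convex Q" by (simp add: Q_def convex_shaved_ball)
  moreover have "K \<subseteq> Q"
  proof -
    have "K \<subseteq> cball 0 (R0 / 2)" using b(2) R0(2) subset_cball[of b "R0 / 2" "0::'a"] by simp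
    also have "\<dots> \<subseteq> Q" unfolding Q_def using R0(1) \<epsilon>(3) by (intro cball_subset_shaved_ball) auto
    finally show ?thesis .
  qed
  moreover have "phi_map v \<gamma> ` Q \<subseteq> Q" if "\<gamma> \<in> P" for \<gamma>
    using step[of R0 _ 0 \<gamma>] that by (simp add: Q_def image_subset_iff)
  moreover have "\<exists>n0::nat. \<forall>gs. length gs > n0 \<and> set gs \<subseteq> P0 \<longrightarrow> phi_comp v gs ` X \<subseteq> Q"
    if P0: "compact P0" "P0 \<subseteq> interior P" "compact X" for P0 X
  proof -
    obtain e where e: "e > 0" "(\<Union>\<gamma>\<in>P0. cball \<gamma> e) \<subseteq> interior P"
      using compact_subset_open_imp_cball_epsilon_subset[OF P0(1) open_interior P0(2)] by auto
    \<comment> \<open>Capped at 1, the largest decrease that \<open>step\<close> allows.\<close>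
    define s where "s = min 1 e"
    have s: "0 < s" "s \<le> 1" "s \<le> e" using e by (auto simp: s_def)
    have slack: "\<gamma> + s *\<^sub>R n \<in> P" if "\<gamma> \<in> P0" "norm n = 1" for \<gamma> n
    proof -
      have "\<gamma> + s *\<^sub>R n \<in> cball \<gamma> e" using that s by (simp add: dist_norm)
      then show ?thesis using e(2) that(1) interior_subset by blast
    qed
    obtain c where c: "c > 0" "X \<subseteq> cball 0 c"
      using bounded_subset_ballD[OF compact_imp_bounded[OF P0(3)], of 0] ball_subset_cball
      subset_trans by metis
    \<comment> \<open>Depths of at most 1/2 keep only the ball of half the radius, hence
      \<open>2 * c\<close>.\<close>
    have X: "X \<subseteq> shaved_ball V \<epsilon> (2 * c)"
      using c cball_subset_shaved_ball[of "2 * c" \<epsilon> V, OF _ \<epsilon>(3)] by simp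
    \<comment> \<open>\<open>step\<close> applies only from \<open>R0\<close> upwards, so the
      decreasing radius is floored there; the head of the list is the map applied last.\<close>
    have iter: "phi_comp v gs x \<in> shaved_ball V \<epsilon> (max R0 (2 * c - real (length gs) * s))"
      if "x \<in> X" "set gs \<subseteq> P0" for gs x
      using that(2)
    proof (induction gs)
      case Nil
      then show ?case using X that(1) sub[of "2 * c" "max R0 (2 * c)"] by auto
    next
      case (Cons g gs)
      then have g: "g \<in> P0" and IH:
        "phi_comp v gs x \<in> shaved_ball V \<epsilon> (max R0 (2 * c - real (length gs) * s))" by auto
      have "g \<in> P" using g P0(2) interior_subset by blast
      then have "phi_map v g (phi_comp v gs x)
          \<in> shaved_ball V \<epsilon> (max R0 (2 * c - real (length gs) * s) - s)"
        using step[OF _ IH] s slack[OF g] by simp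
      moreover have "max R0 (2 * c - real (length gs) * s) - s
          \<le> max R0 (2 * c - real (length (g # gs)) * s)"
        using s by (auto simp: algebra_simps max_def)
      ultimately show ?case using sub by auto
    qed
    \<comment> \<open>More than \<open>2 * c / s\<close> decrements exhaust the initial radius, so
      the maximum equals \<open>R0\<close>.\<close>
    obtain n0 :: nat where n0: "2 * c / s < real n0" using reals_Archimedean2 by blast
    have "phi_comp v gs ` X \<subseteq> Q" if "length gs > n0" "set gs \<subseteq> P0" for gs
    proof -
      have "2 * c / s < real (length gs)" using n0 that(1) by linarith
      then have "2 * c - real (length gs) * s \<le> R0" using s R0(1) by (simp add: pos_divide_less_eq)
      then show ?thesis using iter[OF _ that(2)] by (auto simp: Q_def max_absorb1)
    qed
    then show ?thesis by blast
  qed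
  ultimately show ?thesis by (intro exI[of _ Q]) simp
qed

end
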